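(* Let $G$ be a finite group and let $p$ be a prime. If $x \in G$ is a $p$-element and $$\frac{|\mathbf{C}_G(x)_p|}{|G_p|} > \frac{1}{p},$$ then $x \in \mathbf{Z}(\mathbf{O}_p(G))$.
   Context: A $p$-element is an element of order $p^m$ for some $m \geq 0$. For a finite group $H$, $H_p$ denotes the set of $p$-elements of $H$ (including the identity) and $\mathbf{Z}(H)$ is the center of $H$. $\mathbf{C}_G(x)$ is the centralizer of $x$ in $G$, so $\mathbf{C}_G(x)_p$ is the set of $p$-elements of $G$ commuting with $x$. $\mathbf{O}_p(G)$ is the largest normal $p$-subgroup of $G$. *)

theory Defs
  imports Complex_Main "HOL-Computational_Algebra.Primes" "HOL-Algebra.Multiplicative_Group" "HOL-Algebra.SndIsomorphismGrp"
begin

definition p_elements :: "('a, 'b) monoid_scheme \<Rightarrow> nat \<Rightarrow> 'a set" where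
  "p_elements H p = {x \<in> carrier H. \<exists>m::nat. group.ord H x = p ^ m}"

definition centralizer :: "('a, 'b) monoid_scheme \<Rightarrow> 'a \<Rightarrow> 'a set" where
  "centralizer G x = {g \<in> carrier G. g \<otimes>\<^bsub>G\<^esub> x = x \<otimes>\<^bsub>G\<^esub> g}"

definition center :: "('a, 'b) monoid_scheme \<Rightarrow> 'a set" where
  "center H = {z \<in> carrier H. \<forall>h \<in> carrier H. z \<otimes>\<^bsub>H\<^esub> h = h \<otimes>\<^bsub>H\<^esub> z}"

definition normal_p_subgroup :: "('a, 'b) monoid_scheme \<Rightarrow> nat \<Rightarrow> 'a set \<Rightarrow> bool" where
  "normal_p_subgroup G p N \<longleftrightarrow> N \<lhd> G \<and> (\<exists>m::nat. card N = p ^ m)"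

text \<open>The greatest element is taken with respect to inclusion; for finite groups and prime
  numbers it exists by \<open>p_core_greatest\<close> below.\<close>

definition p_core :: "('a, 'b) monoid_scheme \<Rightarrow> nat \<Rightarrow> 'a set" where
  "p_core G p = (GREATEST N. normal_p_subgroup G p N)"

lemma centralizer_subgroup:
  assumes "group G" and x: "x \<in> carrier G"
  shows "subgroup (centralizer G x) G"
proof -
  interpret group G by fact
  show ?thesis
  proof (rule subgroupI)
    show "centralizer G x \<noteq> {}"
      using x by (auto simp: centralizer_def intro!: exI[of _ "\<one>\<^bsub>G\<^esub>"])
  next
    fix a assume a: "a \<in> centralizer G x"
    then have aG: "a \<in> carrier G" and ax: "a \<otimes>\<^bsub>G\<^esub> x = x \<otimes>\<^bsub>G\<^esub> a"
      by (auto simp: centralizer_def)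
    have "inv\<^bsub>G\<^esub> a \<otimes>\<^bsub>G\<^esub> x = x \<otimes>\<^bsub>G\<^esub> inv\<^bsub>G\<^esub> a"
      by (metis aG ax x inv_closed inv_solve_left inv_solve_right m_assoc m_closed)
    then show "inv\<^bsub>G\<^esub> a \<in> centralizer G x"
      using aG by (simp add: centralizer_def)
  next
    fix a b assume "a \<in> centralizer G x" "b \<in> centralizer G x"
    then show "a \<otimes>\<^bsub>G\<^esub> b \<in> centralizer G x"
      using x by (simp add: centralizer_def) (metis m_assoc)
  qed (auto simp: centralizer_def)
qed

lemma p_elements_subgroup:
  assumes "group G" and H: "subgroup H G"
  shows "p_elements (G\<lparr>carrier := H\<rparr>) p = p_elements G p \<inter> H"
proof -
  interpret group G by fact
  interpret H: group "G\<lparr>carrier := H\<rparr>"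
    using H by (rule subgroup_imp_group)
  have "H.ord x = ord x" for x
    by (simp add: H.ord_def ord_def flip: nat_pow_consistent)
  then show ?thesis
    using subgroup.subset[OF H] by (auto simp: p_elements_def)
qed

lemma normal_p_subgroup_set_mult:
  assumes "group G" "finite (carrier G)" "prime p"
    and M: "normal_p_subgroup G p M" and N: "normal_p_subgroup G p N"
  shows "normal_p_subgroup G p (M <#>\<^bsub>G\<^esub> N)"
proof -
  interpret group G by fact
  have nM: "M \<lhd> G" and nN: "N \<lhd> G"
    using M N by (auto simp: normal_p_subgroup_def)
  interpret second_isomorphism_grp M G N
    using nM nN
    by (simp add: second_isomorphism_grp_def second_isomorphism_grp_axioms_def normal_imp_subgroup)
  let ?MN = "G\<lparr>carrier := M <#>\<^bsub>G\<^esub> N\<rparr>" and ?N = "G\<lparr>carrier := N\<rparr>"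
  interpret MN: group ?MN
    by (rule subgroup_imp_group[OF normal_set_mult_subgroup])
  interpret N: group ?N
    by (rule subgroup_imp_group[OF subgrpS])
  have "subgroup M ?MN"
    by (simp add: H_contained_in_set_mult is_subgroup normal_set_mult_subgroup subgroup_incl)
  then have 1: "card (rcosets\<^bsub>?MN\<^esub> M) * card M = card (M <#>\<^bsub>G\<^esub> N)"
    using MN.lagrange[of M] by (simp add: order_def)
  have "subgroup (M \<inter> N) ?N"
    using normal_subgrp_intersection_normal by (simp add: normal_imp_subgroup Int_commute)
  then have 2: "card (rcosets\<^bsub>?N\<^esub> (M \<inter> N)) * card (M \<inter> N) = card N"
    using N.lagrange[of "M \<inter> N"] by (simp add: order_def)
  have "card (carrier (?N Mod (M \<inter> N))) = card (carrier (?MN Mod M))"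
    using normal_intersection_quotient_isom by (intro iso_same_card) (auto simp: is_iso_def)
  then have "card (rcosets\<^bsub>?N\<^esub> (M \<inter> N)) = card (rcosets\<^bsub>?MN\<^esub> M)"
    by (simp add: FactGroup_def)
  with 1 2 have "card (M <#>\<^bsub>G\<^esub> N) dvd card N * card M"
    by (metis dvd_triv_left mult_dvd_mono dvd_refl)
  moreover obtain m n where "card M = p ^ m" "card N = p ^ n"
    using M N by (auto simp: normal_p_subgroup_def)
  ultimately have "card (M <#>\<^bsub>G\<^esub> N) dvd p ^ (n + m)"
    by (simp add: power_add)
  then show ?thesis
    using \<open>prime p\<close> nM nN normal_subgroup_set_mult_closed
    by (auto simp: normal_p_subgroup_def divides_primepow_nat)
qed

lemma p_core_greatest:
  assumes "group G" "finite (carrier G)" "prime p"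
  shows "normal_p_subgroup G p (p_core G p)"
    and "normal_p_subgroup G p N \<Longrightarrow> N \<subseteq> p_core G p"
proof -
  interpret group G by fact
  have sub: "N \<subseteq> carrier G" if "normal_p_subgroup G p N" for N
    using that by (simp add: normal_p_subgroup_def normal_imp_subgroup subgroup.subset)
  let ?S = "{N. normal_p_subgroup G p N}"
  have "finite ?S"
    by (rule finite_subset[of _ "Pow (carrier G)"]) (use sub assms in auto)
  moreover have "{\<one>\<^bsub>G\<^esub>} \<in> ?S"
    using one_is_normal by (auto simp: normal_p_subgroup_def intro!: exI[of _ 0])
  ultimately obtain M where M: "normal_p_subgroup G p M"
    and max: "\<And>N. normal_p_subgroup G p N \<Longrightarrow> M \<subseteq> N \<Longrightarrow> M = N"
    using finite_has_maximal[of ?S] by blast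
  have le: "N \<subseteq> M" if N: "normal_p_subgroup G p N" for N
  proof -
    interpret second_isomorphism_grp M G N
      using M N
      by (simp add: second_isomorphism_grp_def second_isomorphism_grp_axioms_def
          normal_p_subgroup_def normal_imp_subgroup)
    have "M = M <#>\<^bsub>G\<^esub> N"
      using max normal_p_subgroup_set_mult[OF assms M N] H_contained_in_set_mult by blast
    then show ?thesis
      using S_contained_in_set_mult by simp
  qed
  have "p_core G p = M"
    unfolding p_core_def by (rule Greatest_equality) (use M le in auto)
  then show "normal_p_subgroup G p (p_core G p)"
    and "normal_p_subgroup G p N \<Longrightarrow> N \<subseteq> p_core G p"
    using M le by auto
qed

end

theory Submission
  imports Defs "HOL-Algebra.Group_Action"
begin

text \<open>
  If an element \<open>n\<close> of the core fails to commute with \<open>x\<close>, then \<open>(c, i) \<mapsto> c n\<^sup>i\<close> embeds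
  \<open>C\<^sub>G(x)\<^sub>p \<times> {0, \<dots>, p - 1}\<close> into \<open>G\<^sub>p\<close>; so \<open>x\<close> centralizes the core, and it remains to show that it
  lies in the core. Otherwise let \<open>K\<close> be a smallest subgroup containing a conjugate of \<open>x\<close> outside
  \<open>O\<^sub>p(K)\<close>, and \<open>D\<close> the set of all such conjugates in \<open>K\<close>. As in Baer's theorem, minimality makes the
  maximal subsets of \<open>D\<close> lying in \<open>p\<close>-subgroups of \<open>K\<close> pairwise disjoint, and each of them has at most
  \<open>|D| / (p + 1)\<close> elements. Elements of different maximal subsets generate \<open>K\<close>, so every
  \<open>y\<close> not centralizing \<open>K\<close> commutes with at most \<open>|D| / (p + 1)\<close> elements of \<open>D\<close>; those that do
  centralize \<open>K\<close> make up at most a fraction \<open>1 / p\<close> of \<open>C\<^sub>G(x)\<^sub>p\<close>. Counting commuting pairs in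
  \<open>D \<times> G\<^sub>p\<close> gives \<open>p |C\<^sub>G(x)\<^sub>p| \<le> |G\<^sub>p|\<close>.
\<close>

section \<open>Fixed points of actions of prime power order groups\<close>

text \<open>Orbits have \<open>p\<close>-power size by the orbit-stabilizer theorem. Were
  \<open>{z}\<close> the only orbit of size one, \<open>card E\<close> would be 1 modulo
  \<open>p\<close>.\<close>

lemma (in group_action) exists_another_fixed_point:
  assumes "finite E" and p: "Factorial_Ring.prime (p::nat)" and "order G = p ^ n" and "p dvd card E"
    and z: "z \<in> E" and fix_z: "\<And>g. g \<in> carrier G \<Longrightarrow> \<phi> g z = z"
  shows "\<exists>w\<in>E. w \<noteq> z \<and> (\<forall>g\<in>carrier G. \<phi> g w = w)"
proof (rule ccontr)
  assume none: "\<not> ?thesis"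
  have orbE: "orbit G \<phi> w \<subseteq> E" if "w \<in> E" for w
    using that element_image by (auto simp: orbit_def)
  have "orbit G \<phi> z = {z}"
    using orbit_refl[OF z] fix_z by (auto simp: orbit_def)
  then have z_orb: "{z} \<in> orbits G E \<phi>"
    using z by (auto simp: orbits_def)
  have fin: "finite (orbits G E \<phi>)"
    using \<open>finite E\<close> by (simp add: orbits_def)
  have "p dvd card B" if B: "B \<in> orbits G E \<phi> - {{z}}" for B
  proof -
    obtain w where w: "w \<in> E" "B = orbit G \<phi> w"
      using B by (auto simp: orbits_def)
    have "card B dvd p ^ n"
      using orbit_stabilizer_theorem[OF w(1)] w(2) \<open>order G = p ^ n\<close> by (metis dvd_triv_left)
    then obtain k where k: "card B = p ^ k"
      using p by (auto simp: divides_primepow_nat)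
    have "card B \<noteq> 1"
    proof
      assume "card B = 1"
      then obtain v where "B = {v}"
        using card_1_singletonE by blast
      then have "B = {w}"
        using orbit_refl[OF w(1)] w(2) by auto
      then have "\<forall>g\<in>carrier G. \<phi> g w = w" and "w \<noteq> z"
        using w(2) B by (auto simp: orbit_def)
      with none w(1) show False by blast
    qed
    with k show ?thesis
      by (cases k) auto
  qed
  then have "p dvd (\<Sum>B\<in>orbits G E \<phi> - {{z}}. card B)"
    by (rule dvd_sum)
  moreover have "(\<Sum>B\<in>orbits G E \<phi>. card B) = card E"
    using disjoint_sum[OF \<open>finite E\<close>, of "\<lambda>_. 1::nat"] by simp
  then have "card E = 1 + (\<Sum>B\<in>orbits G E \<phi> - {{z}}. card B)"
    using sum.remove[OF fin z_orb, of card] by simp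
  ultimately have "p dvd 1"
    using \<open>p dvd card E\<close> by (metis dvd_add_left_iff)
  with p show False
    by auto
qed

section \<open>Conjugation of subsets\<close>

context group
begin

definition conjg :: "'a \<Rightarrow> 'a set \<Rightarrow> 'a set" where
  "conjg g S = (\<lambda>s. g \<otimes> s \<otimes> inv g) ` S"

lemma conj_mult:
  "\<lbrakk>g \<in> carrier G; h \<in> carrier G; s \<in> carrier G\<rbrakk>
    \<Longrightarrow> (g \<otimes> h) \<otimes> s \<otimes> inv (g \<otimes> h) = g \<otimes> (h \<otimes> s \<otimes> inv h) \<otimes> inv g"
  by (simp add: inv_mult_group m_assoc)

lemma conjg_mult:
  "\<lbrakk>g \<in> carrier G; h \<in> carrier G; S \<subseteq> carrier G\<rbrakk> \<Longrightarrow> conjg (g \<otimes> h) S = conjg g (conjg h S)"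
  unfolding conjg_def image_image by (rule image_cong) (auto simp: conj_mult)

lemma conjg_one [simp]: "S \<subseteq> carrier G \<Longrightarrow> conjg \<one> S = S"
  unfolding conjg_def by (auto simp: subset_iff image_iff)

lemma conjg_closed: "\<lbrakk>g \<in> carrier G; S \<subseteq> carrier G\<rbrakk> \<Longrightarrow> conjg g S \<subseteq> carrier G"
  by (auto simp: conjg_def)

lemma conjg_inv_cancel:
  assumes "g \<in> carrier G" "S \<subseteq> carrier G"
  shows "conjg (inv g) (conjg g S) = S" "conjg g (conjg (inv g) S) = S"
  using assms by (simp_all flip: conjg_mult)

lemma conj_inj:
  assumes "g \<in> carrier G"
  shows "inj_on (\<lambda>s. g \<otimes> s \<otimes> inv g) (carrier G)"
  using assms by (auto intro!: inj_onI)

lemma card_conjg: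
  assumes "g \<in> carrier G" "S \<subseteq> carrier G"
  shows "card (conjg g S) = card S"
  unfolding conjg_def by (rule card_image[OF inj_on_subset[OF conj_inj[OF assms(1)] assms(2)]])

lemma conjg_eqI:
  assumes "finite S" "g \<in> carrier G" "S \<subseteq> carrier G" "conjg g S \<subseteq> S"
  shows "conjg g S = S"
  using assms card_conjg by (simp add: card_subset_eq)

lemma stabilizer_conjg_subgroup:
  assumes "S \<subseteq> carrier G"
  shows "subgroup {g \<in> carrier G. conjg g S = S} G"
proof (rule subgroupI)
  show "inv a \<in> {g \<in> carrier G. conjg g S = S}" if "a \<in> {g \<in> carrier G. conjg g S = S}" for a
    using that conjg_inv_cancel(1)[of a S] assms by auto
next
  show "a \<otimes> b \<in> {g \<in> carrier G. conjg g S = S}"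
    if "a \<in> {g \<in> carrier G. conjg g S = S}" "b \<in> {g \<in> carrier G. conjg g S = S}" for a b
    using that conjg_mult[of a b S] assms by auto
qed (use assms in auto)

lemma conjg_subgroup:
  assumes H: "subgroup H G" and g: "g \<in> carrier G"
  shows "subgroup (conjg g H) G"
proof (rule subgroupI)
  note HG = subgroup.subset[OF H]
  show "conjg g H \<subseteq> carrier G"
    using conjg_closed g HG .
  show "conjg g H \<noteq> {}"
    using subgroup.one_closed[OF H] by (auto simp: conjg_def)
  show "inv a \<in> conjg g H" if a: "a \<in> conjg g H" for a
  proof -
    obtain h where h: "h \<in> H" "a = g \<otimes> h \<otimes> inv g"
      using a by (auto simp: conjg_def)
    then have "inv a = g \<otimes> inv h \<otimes> inv g"
      using g HG by (simp add: subset_iff inv_mult_group m_assoc)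
    then show ?thesis
      using h(1) subgroup.m_inv_closed[OF H] by (auto simp: conjg_def)
  qed
  show "a \<otimes> b \<in> conjg g H" if ab: "a \<in> conjg g H" "b \<in> conjg g H" for a b
  proof -
    obtain h k where hk: "h \<in> H" "a = g \<otimes> h \<otimes> inv g" "k \<in> H" "b = g \<otimes> k \<otimes> inv g"
      using ab by (auto simp: conjg_def)
    then have "a \<otimes> b = g \<otimes> (h \<otimes> k) \<otimes> inv g"
      using g HG by (simp add: subset_iff m_assoc inv_solve_left')
    then show ?thesis
      using hk subgroup.m_closed[OF H] by (auto simp: conjg_def)
  qed
qed

text \<open>The \<open>restrict\<close> is forced by \<open>BijGroup\<close>, whose elements are
  extensional functions. The acting subgroup is a parameter because two different subgroups will act
  on the same family.\<close>

lemma conjg_action: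
  assumes U: "subgroup U G" and \<Omega>: "\<Omega> \<subseteq> Pow (carrier G)"
    and inv: "\<And>g S. g \<in> U \<Longrightarrow> S \<in> \<Omega> \<Longrightarrow> conjg g S \<in> \<Omega>"
  shows "group_action (G\<lparr>carrier := U\<rparr>) \<Omega> (\<lambda>g. restrict (conjg g) \<Omega>)"
proof -
  note UG = subgroup.mem_carrier[OF U]
  have bij: "restrict (conjg g) \<Omega> \<in> Bij \<Omega>" if g: "g \<in> U" for g
  proof -
    have "bij_betw (conjg g) \<Omega> \<Omega>"
    proof (rule bij_betw_byWitness[of _ "conjg (inv g)"])
      show "\<forall>S\<in>\<Omega>. conjg (inv g) (conjg g S) = S" "\<forall>S\<in>\<Omega>. conjg g (conjg (inv g) S) = S"
        using conjg_inv_cancel UG[OF g] \<Omega> by auto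
    qed (use inv g subgroup.m_inv_closed[OF U] in auto)
    then show ?thesis
      by (simp add: Bij_def)
  qed
  have "restrict (conjg (g \<otimes> h)) \<Omega> = compose \<Omega> (restrict (conjg g) \<Omega>) (restrict (conjg h) \<Omega>)"
    if "g \<in> U" "h \<in> U" for g h
    using that UG inv \<Omega> by (auto simp: compose_def conjg_mult subset_iff intro!: restrict_ext)
  then have "(\<lambda>g. restrict (conjg g) \<Omega>) \<in> hom (G\<lparr>carrier := U\<rparr>) (BijGroup \<Omega>)"
    using bij by (auto simp: hom_def BijGroup_def)
  then show ?thesis
    using subgroup_imp_group[OF U] group_BijGroup
    by (simp add: group_action_def group_hom_def group_hom_axioms_def)
qed

end

section \<open>Prime power order subgroups and elements\<close>

locale finite_group_prime = group G for G (structure) +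
  fixes p :: nat
  assumes finite_carrier: "finite (carrier G)" and prime_p: "Factorial_Ring.prime p"
begin

definition p_subgroup :: "'a set \<Rightarrow> bool" where
  "p_subgroup P \<longleftrightarrow> subgroup P G \<and> (\<exists>m::nat. card P = p ^ m)"

definition core_of :: "'a set \<Rightarrow> 'a set" where
  "core_of L = p_core (G\<lparr>carrier := L\<rparr>) p"

lemma p_subgroup_subgroup: "p_subgroup P \<Longrightarrow> subgroup P G"
  by (simp add: p_subgroup_def)

lemma p_subgroup_subset: "p_subgroup P \<Longrightarrow> P \<subseteq> carrier G"
  by (simp add: p_subgroup_def subgroup.subset)

lemma card_subgroup_dvd:
  assumes "subgroup H G" "subgroup K G" "H \<subseteq> K"
  shows "card H dvd card K"
  using group.lagrange[OF subgroup_imp_group[OF assms(2)] subgroup_incl[OF assms], symmetric]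
  by (simp add: order_def)

lemma p_subgroup_mono:
  assumes "p_subgroup P" "subgroup H G" "H \<subseteq> P"
  shows "p_subgroup H"
  using card_subgroup_dvd[OF assms(2) p_subgroup_subgroup[OF assms(1)] assms(3)] assms prime_p
  by (auto simp: p_subgroup_def divides_primepow_nat)

text \<open>Divisors of a prime power are prime powers, so an annihilating exponent
  \<open>p ^ m\<close> may replace the exact order.\<close>

lemma p_elements_iff: "x \<in> p_elements G p \<longleftrightarrow> x \<in> carrier G \<and> (\<exists>m::nat. x [^] (p ^ m) = \<one>)"
proof
  assume "x \<in> p_elements G p"
  then obtain m where "x \<in> carrier G" "ord x = p ^ m"
    by (auto simp: p_elements_def)
  moreover from this have "x [^] (p ^ m) = \<one>"
    by (metis pow_ord_eq_1)
  ultimately show "x \<in> carrier G \<and> (\<exists>m::nat. x [^] (p ^ m) = \<one>)"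
    by blast
next
  assume *: "x \<in> carrier G \<and> (\<exists>m::nat. x [^] (p ^ m) = \<one>)"
  then obtain m where "ord x dvd p ^ m"
    by (auto simp: pow_eq_id)
  then show "x \<in> p_elements G p"
    using * prime_p by (auto simp: p_elements_def divides_primepow_nat)
qed

lemma p_elements_subset: "p_elements G p \<subseteq> carrier G"
  by (auto simp: p_elements_def)

lemma finite_p_elements: "finite (p_elements G p)"
  using finite_subset[OF p_elements_subset finite_carrier] .

lemma p_subgroup_p_elements:
  assumes "p_subgroup P"
  shows "P \<subseteq> p_elements G p"
proof
  fix x assume x: "x \<in> P"
  note P = p_subgroup_subgroup[OF assms]
  interpret P: group "G\<lparr>carrier := P\<rparr>"
    using P by (rule subgroup_imp_group)
  have "x [^] card P = \<one>"
    using P.pow_order_eq_1[of x] x by (simp add: order_def flip: nat_pow_consistent)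
  then show "x \<in> p_elements G p"
    using assms x subgroup.mem_carrier[OF P] by (auto simp: p_elements_iff p_subgroup_def)
qed

lemma p_subgroup_generate:
  assumes "x \<in> p_elements G p"
  shows "p_subgroup (generate G {x})"
  using assms generate_is_subgroup[of "{x}"] generate_pow_card[of x]
  by (auto simp: p_subgroup_def p_elements_def)

lemma p_elements_commuting_mult:
  assumes "x \<in> p_elements G p" "y \<in> p_elements G p" "x \<otimes> y = y \<otimes> x"
  shows "x \<otimes> y \<in> p_elements G p"
proof -
  obtain m n where m: "x [^] (p ^ m) = \<one>" and n: "y [^] (p ^ n) = \<one>" and c: "x \<in> carrier G" "y \<in> carrier G"
    using assms by (auto simp: p_elements_iff)
  have "x [^] (p ^ (m + n)) = (x [^] (p ^ m)) [^] (p ^ n)"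
    "y [^] (p ^ (m + n)) = (y [^] (p ^ n)) [^] (p ^ m)"
    using c by (simp_all add: nat_pow_pow power_add mult.commute)
  then have "(x \<otimes> y) [^] (p ^ (m + n)) = \<one>"
    using pow_mult_distrib[OF assms(3) c] m n by simp
  then show ?thesis
    using c by (auto simp: p_elements_iff)
qed

lemma p_elements_pow: "x \<in> p_elements G p \<Longrightarrow> x [^] (k::nat) \<in> p_elements G p"
  unfolding p_elements_iff by (metis mult.commute nat_pow_closed nat_pow_one nat_pow_pow)

lemma conj_pow:
  assumes "g \<in> carrier G" "x \<in> carrier G"
  shows "(g \<otimes> x \<otimes> inv g) [^] (k::nat) = g \<otimes> x [^] k \<otimes> inv g"
proof (induction k)
  case (Suc k)
  have "g \<otimes> x [^] k \<otimes> inv g \<otimes> (g \<otimes> x \<otimes> inv g) = g \<otimes> x [^] k \<otimes> (inv g \<otimes> g) \<otimes> x \<otimes> inv g"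
    using assms by (simp only: m_assoc m_closed inv_closed nat_pow_closed)
  then show ?case
    using Suc assms by (simp add: m_assoc)
qed (use assms in simp)

lemma p_elements_conj:
  assumes "g \<in> carrier G" "x \<in> p_elements G p"
  shows "g \<otimes> x \<otimes> inv g \<in> p_elements G p"
proof -
  obtain m where "x \<in> carrier G" "x [^] (p ^ m) = \<one>"
    using assms by (auto simp: p_elements_iff)
  then have "(g \<otimes> x \<otimes> inv g) [^] (p ^ m) = \<one>"
    using assms(1) by (simp add: conj_pow)
  then show ?thesis
    using assms(1) \<open>x \<in> carrier G\<close> by (auto simp: p_elements_iff)
qed

text \<open>The exponent \<open>k\<close> is coprime to the order of \<open>z\<close>, so by Bezout
  \<open>z\<close> is itself a power of \<open>z [^] k\<close>.\<close>

lemma p_element_mem_subgroup_if_pow_mem: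
  assumes z: "z \<in> p_elements G p" and H: "subgroup H G" and k: "0 < k" "k < p"
    and "z [^] (k::nat) \<in> H"
  shows "z \<in> H"
proof -
  obtain m where zG: "z \<in> carrier G" and m: "z [^] (p ^ m) = \<one>"
    using z by (auto simp: p_elements_iff)
  have "\<not> p dvd k"
    using k by (auto dest: dvd_imp_le)
  then have "coprime p k"
    using prime_imp_coprime[OF prime_p] by blast
  then have "gcd k (p ^ m) = 1"
    by (simp add: coprime_commute)
  moreover obtain a b where "k * a = p ^ m * b + gcd k (p ^ m)"
    using bezout_nat[of k "p ^ m"] k by auto
  ultimately have ab: "k * a = p ^ m * b + 1"
    by simp
  have "(z [^] k) [^] a = (z [^] (p ^ m)) [^] b \<otimes> z"
    using zG ab by (simp add: nat_pow_pow)
  then have "z = (z [^] k) [^] a"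
    using m zG by simp
  also have "\<dots> \<in> H"
    using subgroup_int_pow_closed[OF H assms(5), of "int a"] by (simp add: int_pow_int)
  finally show ?thesis .
qed

text \<open>By the preceding lemma the powers of \<open>z\<close> with exponent below
  \<open>p\<close> lie in distinct cosets of \<open>H\<close>. Both embeddings that produce a factor
  \<open>p\<close> rest on this.\<close>

lemma inj_on_mult_p_element_powers:
  assumes z: "z \<in> p_elements G p" and H: "subgroup H G" and "z \<notin> H" and "S \<subseteq> H"
  shows "inj_on (\<lambda>(s, i). s \<otimes> z [^] (i::nat)) (S \<times> {..<p})"
proof -
  have zG: "z \<in> carrier G"
    using z by (simp add: p_elements_def)
  have SG: "s \<in> carrier G" if "s \<in> S" for s
    using that \<open>S \<subseteq> H\<close> subgroup.mem_carrier[OF H] by blast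
  have eq: "i = j" if st: "s \<in> S" "t \<in> S" and ij: "i \<le> j" "j < p" and e: "s \<otimes> z [^] i = t \<otimes> z [^] j"
    for s t i j
  proof (rule ccontr)
    assume "i \<noteq> j"
    have "t \<otimes> z [^] j = t \<otimes> z [^] (j - i) \<otimes> z [^] i"
      using ij zG SG st by (simp add: m_assoc nat_pow_mult)
    then have "s = t \<otimes> z [^] (j - i)"
      using e zG SG st by simp
    then have "z [^] (j - i) = inv t \<otimes> s"
      using zG SG st by (simp add: inv_solve_left)
    then have "z [^] (j - i) \<in> H"
      using st \<open>S \<subseteq> H\<close> subgroup.m_closed[OF H] subgroup.m_inv_closed[OF H] by (simp add: subset_iff)
    then show False
      using p_element_mem_subgroup_if_pow_mem[OF z H, of "j - i"] \<open>i \<noteq> j\<close> ij \<open>z \<notin> H\<close> by linarith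
  qed
  show ?thesis
  proof (rule inj_onI, clarsimp)
    fix s t i j assume *: "s \<in> S" "t \<in> S" "i < p" "j < p" "s \<otimes> z [^] i = t \<otimes> z [^] j"
    have "i = j"
      using eq[of s t i j] eq[of t s j i] * by (cases "i \<le> j") auto
    with * show "s = t \<and> i = j"
      using SG zG by simp
  qed
qed

section \<open>The \<open>p\<close>-core of a subgroup, described inside the ambient group\<close>

lemma core_of_p_subgroup:
  assumes L: "subgroup L G"
  shows "p_subgroup (core_of L)" and "core_of L \<subseteq> L"
    and "\<And>g n. g \<in> L \<Longrightarrow> n \<in> core_of L \<Longrightarrow> g \<otimes> n \<otimes> inv g \<in> core_of L"
proof -
  have fin: "finite (carrier (G\<lparr>carrier := L\<rparr>))"
    using finite_carrier subgroup.subset[OF L] by (auto intro: finite_subset)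
  interpret L: group "G\<lparr>carrier := L\<rparr>"
    using L by (rule subgroup_imp_group)
  have nps: "normal_p_subgroup (G\<lparr>carrier := L\<rparr>) p (core_of L)"
    unfolding core_of_def by (rule p_core_greatest(1)[OF L.is_group fin prime_p])
  then have nrm: "core_of L \<lhd> G\<lparr>carrier := L\<rparr>"
    by (simp add: normal_p_subgroup_def)
  note sub = normal_imp_subgroup[OF nrm]
  show "core_of L \<subseteq> L"
    using subgroup.subset[OF sub] by simp
  show "p_subgroup (core_of L)"
    using incl_subgroup[OF L sub] nps by (simp add: p_subgroup_def normal_p_subgroup_def)
  show "g \<otimes> n \<otimes> inv g \<in> core_of L" if "g \<in> L" "n \<in> core_of L" for g n
    using L.normal_invE(2)[OF nrm, of g n] that L by simp
qed

text \<open>Normality in \<open>L\<close> is stated as closure under conjugation in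
  \<open>G\<close>, so that later arguments need not change the ambient group.\<close>

lemma core_of_greatest:
  assumes L: "subgroup L G" and N: "p_subgroup N" "N \<subseteq> L"
    and inv: "\<And>g n. g \<in> L \<Longrightarrow> n \<in> N \<Longrightarrow> g \<otimes> n \<otimes> inv g \<in> N"
  shows "N \<subseteq> core_of L"
proof -
  have fin: "finite (carrier (G\<lparr>carrier := L\<rparr>))"
    using finite_carrier subgroup.subset[OF L] by (auto intro: finite_subset)
  interpret L: group "G\<lparr>carrier := L\<rparr>"
    using L by (rule subgroup_imp_group)
  have "N \<lhd> G\<lparr>carrier := L\<rparr>"
  proof (rule L.normal_invI)
    show "subgroup N (G\<lparr>carrier := L\<rparr>)"
      using subgroup_incl[OF p_subgroup_subgroup[OF N(1)] L N(2)] .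
  qed (use inv L in simp)
  then have "normal_p_subgroup (G\<lparr>carrier := L\<rparr>) p N"
    using N(1) by (simp add: normal_p_subgroup_def p_subgroup_def)
  then show ?thesis
    unfolding core_of_def by (rule p_core_greatest(2)[OF L.is_group fin prime_p])
qed

text \<open>The trace of a \<open>p\<close>-subgroup \<open>P\<close> on a conjugation-invariant set \<open>D\<close> inherits from \<open>P\<close>
  the growth of normalizers of proper subgroups.\<close>

lemma normalizer_grows_on_trace:
  assumes P: "p_subgroup P" and Q: "p_subgroup Q" and "D \<subseteq> carrier G"
    and D: "\<And>g d. g \<in> P \<Longrightarrow> d \<in> D \<Longrightarrow> g \<otimes> d \<otimes> inv g \<in> D"
    and not_sub: "\<not> D \<inter> P \<subseteq> Q"
  shows "\<exists>d\<in>D \<inter> P - Q. conjg d (D \<inter> P \<inter> Q) = D \<inter> P \<inter> Q"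
proof -
  define T where "T = D \<inter> P \<inter> Q"
  \<comment> \<open>\<open>P\<close> permutes the conjugates of \<open>T\<close> transitively, so
    their number is a power of \<open>p\<close>. When it exceeds one, the group
    \<open>P \<inter> Q\<close>, which fixes \<open>T\<close>, must fix a second conjugate.\<close>
  define \<Omega> where "\<Omega> = (\<lambda>v. conjg v T) ` P"
  have sP: "subgroup P G" and sU: "subgroup (P \<inter> Q) G"
    using P Q by (auto simp: p_subgroup_def subgroups_Inter_pair)
  have PG: "g \<in> carrier G" if "g \<in> P" for g
    using that subgroup.mem_carrier[OF sP] by blast
  have TG: "T \<subseteq> carrier G" and T_fin: "finite T"
    using \<open>D \<subseteq> carrier G\<close> finite_carrier by (auto simp: T_def intro: finite_subset)
  have DP: "g \<otimes> d \<otimes> inv g \<in> D \<inter> P" if "g \<in> P" "d \<in> D \<inter> P" for g d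
    using that D subgroup.m_closed[OF sP] subgroup.m_inv_closed[OF sP] by auto
  show ?thesis
  proof (cases "\<forall>v\<in>P. conjg v T = T")
    case True
    then show ?thesis
      using not_sub by (auto simp: T_def)
  next
    case False
    have \<Omega>_fin: "finite \<Omega>" and \<Omega>_sub: "\<Omega> \<subseteq> Pow (carrier G)"
      using finite_subset[OF p_subgroup_subset[OF P] finite_carrier] conjg_closed PG TG
      by (auto simp: \<Omega>_def dest: subsetD)
    have \<Omega>_inv: "conjg g S \<in> \<Omega>" if "g \<in> P" "S \<in> \<Omega>" for g S
      using that PG TG subgroup.m_closed[OF sP] by (auto simp: \<Omega>_def simp flip: conjg_mult)
    have T_\<Omega>: "T \<in> \<Omega>"
      using subgroup.one_closed[OF sP] TG by (auto simp: \<Omega>_def intro!: image_eqI[of _ _ \<one>])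
    interpret P: group_action "G\<lparr>carrier := P\<rparr>" \<Omega> "\<lambda>g. restrict (conjg g) \<Omega>"
      by (rule conjg_action[OF sP \<Omega>_sub \<Omega>_inv])
    interpret U: group_action "G\<lparr>carrier := P \<inter> Q\<rparr>" \<Omega> "\<lambda>g. restrict (conjg g) \<Omega>"
      by (rule conjg_action[OF sU \<Omega>_sub \<Omega>_inv]) auto
    have "orbit (G\<lparr>carrier := P\<rparr>) (\<lambda>g. restrict (conjg g) \<Omega>) T = \<Omega>"
      using T_\<Omega> by (auto simp: orbit_def \<Omega>_def)
    then have "card \<Omega> dvd card P"
      using P.orbit_stabilizer_theorem[OF T_\<Omega>, symmetric] by (simp add: order_def)
    then obtain k where k: "card \<Omega> = p ^ k"
      using P prime_p by (auto simp: p_subgroup_def divides_primepow_nat)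
    have "card \<Omega> \<noteq> 1"
    proof
      assume "card \<Omega> = 1"
      then obtain S where "\<Omega> = {S}"
        using card_1_singletonE by blast
      moreover obtain v where "v \<in> P" "conjg v T \<noteq> T"
        using False by blast
      moreover from this have "conjg v T \<in> \<Omega>"
        by (simp add: \<Omega>_def)
      ultimately show False
        using T_\<Omega> by blast
    qed
    with k have "p dvd card \<Omega>"
      by (cases k) auto
    obtain n where "order (G\<lparr>carrier := P \<inter> Q\<rparr>) = p ^ n"
      using p_subgroup_mono[OF P sU] by (auto simp: p_subgroup_def order_def)
    have U_fix: "conjg g T = T" if g: "g \<in> P \<inter> Q" for g
    proof (rule conjg_eqI[OF T_fin _ TG])
      show "conjg g T \<subseteq> T"
        using DP g subgroup.m_closed[OF sU] subgroup.m_inv_closed[OF sU]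
        by (auto simp: T_def conjg_def)
    qed (use g PG in auto)
    have "\<exists>W\<in>\<Omega>. W \<noteq> T \<and> (\<forall>g\<in>carrier (G\<lparr>carrier := P \<inter> Q\<rparr>). restrict (conjg g) \<Omega> W = W)"
      by (rule U.exists_another_fixed_point[OF \<Omega>_fin prime_p \<open>order _ = p ^ n\<close> \<open>p dvd card \<Omega>\<close> T_\<Omega>])
        (use U_fix T_\<Omega> in simp)
    then obtain W where W: "W \<in> \<Omega>" "W \<noteq> T" and W_fix: "\<And>g. g \<in> P \<inter> Q \<Longrightarrow> conjg g W = W"
      by auto
    obtain v where v: "v \<in> P" "W = conjg v T"
      using W(1) by (auto simp: \<Omega>_def)
    \<comment> \<open>Conjugates have equally many elements, so distinct ones are never
      nested.\<close>
    have "\<not> T \<subseteq> W"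
      using card_subset_eq[of W T] card_conjg[OF PG[OF v(1)] TG] W(2) v(2) T_fin
      by (auto simp: conjg_def)
    then obtain t where t: "t \<in> T" "t \<notin> W"
      by blast
    \<comment> \<open>Elements of \<open>T\<close> lie in \<open>P \<inter> Q\<close> and so
      stabilize \<open>W = conjg v T\<close>; conjugated back by \<open>inv v\<close> they stabilize
      \<open>T\<close>. Choosing \<open>t\<close> outside \<open>W\<close> keeps \<open>d\<close>
      outside \<open>Q\<close>.\<close>
    define d where "d = inv v \<otimes> t \<otimes> v"
    have tP: "t \<in> P" and tG: "t \<in> carrier G" and vG: "v \<in> carrier G"
      using t v PG TG by (auto simp: T_def)
    have "d \<in> D \<inter> P"
      using DP[of "inv v" t] v t subgroup.m_inv_closed[OF sP] vG by (auto simp: d_def T_def)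
    moreover have "d \<notin> Q"
    proof
      assume "d \<in> Q"
      then have "d \<in> T"
        using \<open>d \<in> D \<inter> P\<close> by (simp add: T_def)
      moreover have "v \<otimes> d \<otimes> inv v = t"
        using vG tG conj_mult[of v "inv v" t] by (simp add: d_def)
      ultimately show False
        using t(2) v(2) by (auto simp: conjg_def)
    qed
    moreover have "conjg d T = T"
    proof -
      have "conjg d T = conjg (inv v) (conjg t (conjg v T))"
        using vG tG TG by (simp add: d_def conjg_mult conjg_closed)
      also have "conjg t (conjg v T) = conjg v T"
        using W_fix[of t] t(1) v(2) by (simp add: T_def)
      finally show ?thesis
        using conjg_inv_cancel(1)[OF vG TG] by simp
    qed
    ultimately show ?thesis
      by (auto simp: T_def)
  qed
qed

end

section \<open>A minimal subgroup in which a conjugate escapes the core\<close>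

text \<open>\<open>X\<close> will be the conjugacy class of \<open>x\<close>. Equality of the
  centralizer counts on it enters only as the hypothesis of
  \<open>card_p_elements_ge\<close>.\<close>

locale minimal_escape = finite_group_prime +
  fixes X K :: "'a set"
  assumes X_p: "X \<subseteq> p_elements G p"
    and X_conj: "\<And>g x. g \<in> carrier G \<Longrightarrow> x \<in> X \<Longrightarrow> g \<otimes> x \<otimes> inv g \<in> X"
    and K: "subgroup K G"
    and escape: "\<not> X \<inter> K \<subseteq> core_of K"
    and minimal: "\<And>L. subgroup L G \<Longrightarrow> L \<subset> K \<Longrightarrow> X \<inter> L \<subseteq> core_of L"
begin

definition D :: "'a set" where
  "D = X \<inter> K - core_of K"

text \<open>Quantifying over the \<open>p\<close>-subgroup makes the notion stable under conjugation
  by \<open>K\<close>. Maximal clusters take over the role of Sylow subgroups.\<close>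

definition cluster :: "'a set \<Rightarrow> bool" where
  "cluster T \<longleftrightarrow> T \<subseteq> D \<and> (\<exists>P. p_subgroup P \<and> P \<subseteq> K \<and> T \<subseteq> P)"

definition max_cluster :: "'a set \<Rightarrow> bool" where
  "max_cluster B \<longleftrightarrow> cluster B \<and> (\<forall>C. cluster C \<longrightarrow> B \<subseteq> C \<longrightarrow> C = B)"

lemma KG: "k \<in> K \<Longrightarrow> k \<in> carrier G"
  using subgroup.mem_carrier[OF K] .

lemma D_sub: "D \<subseteq> K" "D \<subseteq> carrier G" "D \<subseteq> p_elements G p"
  using X_p KG by (auto simp: D_def)

lemma finite_D: "finite D"
  using finite_subset[OF D_sub(2) finite_carrier] .

lemma D_nonempty: "D \<noteq> {}"
  using escape by (auto simp: D_def)

lemma D_conj: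
  assumes g: "g \<in> K" and d: "d \<in> D"
  shows "g \<otimes> d \<otimes> inv g \<in> D"
proof -
  have gG: "g \<in> carrier G" and dG: "d \<in> carrier G"
    using KG g d D_sub by auto
  have "d \<in> core_of K" if "g \<otimes> d \<otimes> inv g \<in> core_of K"
    using core_of_p_subgroup(3)[OF K subgroup.m_inv_closed[OF K g] that] conj_mult[of "inv g" g d] gG dG
    by simp
  then show ?thesis
    using d g gG X_conj subgroup.m_closed[OF K] subgroup.m_inv_closed[OF K] by (auto simp: D_def)
qed

section \<open>Closure properties of clusters\<close>

lemma cluster_D: "cluster T \<Longrightarrow> T \<subseteq> D"
  by (simp add: cluster_def)

lemma cluster_carrier: "cluster T \<Longrightarrow> T \<subseteq> carrier G"
  using cluster_D D_sub(2) by blast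

lemma finite_cluster: "cluster T \<Longrightarrow> finite T"
  using finite_subset[OF cluster_D finite_D] .

lemma finite_clusters: "finite {T. cluster T}"
  by (rule finite_subset[of _ "Pow D"]) (use cluster_D finite_D in auto)

lemma cluster_mono: "cluster T \<Longrightarrow> S \<subseteq> T \<Longrightarrow> cluster S"
  unfolding cluster_def by blast

lemma cluster_singleton:
  assumes "d \<in> D"
  shows "cluster {d}"
proof -
  have "p_subgroup (generate G {d})" "generate G {d} \<subseteq> K"
    using p_subgroup_generate[of d] generate_subgroup_incl[OF _ K, of "{d}"] assms D_sub by auto
  then show ?thesis
    using assms generate.incl[of d "{d}" G] by (auto simp: cluster_def)
qed

lemma cluster_conjg:
  assumes "cluster T" and k: "k \<in> K"
  shows "cluster (conjg k T)"
proof -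
  obtain P where P: "p_subgroup P" "P \<subseteq> K" "T \<subseteq> P"
    using assms by (auto simp: cluster_def)
  have "p_subgroup (conjg k P)"
    using conjg_subgroup[of P k] card_conjg[of k P] P(1) KG[OF k] p_subgroup_subset[OF P(1)]
    by (simp add: p_subgroup_def)
  moreover have "conjg k P \<subseteq> K"
    using P(2) k subgroup.m_closed[OF K] subgroup.m_inv_closed[OF K] by (auto simp: conjg_def)
  moreover have "conjg k T \<subseteq> conjg k P"
    using P(3) by (auto simp: conjg_def)
  moreover have "conjg k T \<subseteq> D"
    using D_conj[OF k] cluster_D[OF assms(1)] by (auto simp: conjg_def)
  ultimately show ?thesis
    by (auto simp: cluster_def)
qed

text \<open>A cluster fixed by all of \<open>K\<close> generates a \<open>p\<close>-subgroup normal
  in \<open>K\<close>. This lies in the core, which \<open>D\<close> avoids.\<close>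

lemma cluster_moved:
  assumes T: "cluster T" and "T \<noteq> {}"
  shows "\<exists>k\<in>K. conjg k T \<noteq> T"
proof (rule ccontr)
  assume "\<not> ?thesis"
  then have fixed: "conjg k T = T" if "k \<in> K" for k
    using that by blast
  obtain P where P: "p_subgroup P" "P \<subseteq> K" "T \<subseteq> P"
    using T by (auto simp: cluster_def)
  define N where "N = generate G T"
  note TG = cluster_carrier[OF T]
  have N: "subgroup N G" "N \<subseteq> P" "T \<subseteq> N"
    using generate_is_subgroup[OF TG] generate_subgroup_incl[OF P(3) p_subgroup_subgroup[OF P(1)]]
      generate.incl[of _ T G] by (auto simp: N_def)
  have "g \<otimes> n \<otimes> inv g \<in> N" if g: "g \<in> K" and n: "n \<in> N" for g n
  proof -
    have gG: "g \<in> carrier G" and ig: "inv g \<in> K"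
      using g KG subgroup.m_inv_closed[OF K] by auto
    have "conjg (inv g) T \<subseteq> conjg (inv g) N"
      using N(3) by (auto simp: conjg_def)
    \<comment> \<open>The right side is a subgroup containing \<open>conjg (inv g) T = T\<close>,
      hence everything that \<open>T\<close> generates.\<close>
    then have "N \<subseteq> conjg (inv g) N"
      unfolding N_def using fixed[OF ig] conjg_subgroup[OF N(1), of "inv g"] gG
      by (simp add: generate_subgroup_incl N_def)
    then obtain m where m: "m \<in> N" "n = inv g \<otimes> m \<otimes> inv (inv g)"
      using n by (auto simp: conjg_def)
    then have "g \<otimes> n \<otimes> inv g = m"
      using gG conj_mult[of g "inv g" m] subgroup.mem_carrier[OF N(1)] by simp
    with m(1) show ?thesis
      by simp
  qed
  then have "N \<subseteq> core_of K"
    using core_of_greatest[OF K p_subgroup_mono[OF P(1) N(1,2)]] N(2) P(2) by blast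
  then show False
    using \<open>T \<noteq> {}\<close> N(3) cluster_D[OF T] by (auto simp: D_def)
qed

text \<open>Here the minimality of \<open>K\<close> enters: in a proper subgroup the generators lie
  in its core, which is the required \<open>p\<close>-subgroup.\<close>

lemma cluster_if_generate_ne:
  assumes "S \<subseteq> D" and "generate G S \<noteq> K"
  shows "cluster S"
proof -
  have SG: "S \<subseteq> carrier G" and SK: "S \<subseteq> K"
    using assms D_sub by auto
  note L = generate_is_subgroup[OF SG]
  have LK: "generate G S \<subset> K"
    using generate_subgroup_incl[OF SK K] assms(2) by blast
  have "S \<subseteq> core_of (generate G S)"
    using minimal[OF L LK] assms(1) generate.incl[of _ S G] by (auto simp: D_def)
  then show ?thesis
    using core_of_p_subgroup[OF L] LK assms(1) unfolding cluster_def by blast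
qed

text \<open>The stabilizer of \<open>T\<close> does not contain \<open>K\<close>, so its elements
  cannot generate \<open>K\<close>.\<close>

lemma cluster_if_stabilizes:
  assumes T: "cluster T" "T \<noteq> {}" and "S \<subseteq> D" and stab: "\<And>s. s \<in> S \<Longrightarrow> conjg s T = T"
  shows "cluster S"
proof (rule cluster_if_generate_ne[OF \<open>S \<subseteq> D\<close>])
  have "S \<subseteq> {g \<in> carrier G. conjg g T = T}"
    using stab subset_trans[OF \<open>S \<subseteq> D\<close> D_sub(2)] by blast
  then have "generate G S \<subseteq> {g \<in> carrier G. conjg g T = T}"
    by (rule generate_subgroup_incl[OF _ stabilizer_conjg_subgroup[OF cluster_carrier[OF T(1)]]])
  moreover obtain k where "k \<in> K" "conjg k T \<noteq> T"
    using cluster_moved[OF T] by blast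
  ultimately show "generate G S \<noteq> K"
    by blast
qed

lemma trace_stable:
  assumes P: "subgroup P G" "P \<subseteq> K" and s: "s \<in> P"
  shows "conjg s (D \<inter> P) = D \<inter> P"
proof (rule conjg_eqI)
  show "finite (D \<inter> P)" "D \<inter> P \<subseteq> carrier G"
    using finite_D D_sub by auto
  show "s \<in> carrier G"
    using s P KG by blast
  show "conjg s (D \<inter> P) \<subseteq> D \<inter> P"
    using s P D_conj subgroup.m_closed[OF P(1)] subgroup.m_inv_closed[OF P(1)] by (auto simp: conjg_def)
qed

section \<open>Maximal clusters and their intersections\<close>

lemma max_cluster_ext:
  assumes "cluster T"
  obtains B where "max_cluster B" "T \<subseteq> B"
proof -
  obtain B where "cluster B" "T \<subseteq> B" "\<forall>C\<in>{T. cluster T}. B \<subseteq> C \<longrightarrow> B = C"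
    using finite_has_maximal2[OF finite_clusters, of T] assms by auto
  then show ?thesis
    using that[of B] by (auto simp: max_cluster_def)
qed

lemma max_cluster_trace:
  assumes "max_cluster B"
  obtains P where "p_subgroup P" "P \<subseteq> K" "B = D \<inter> P"
proof -
  obtain P where P: "p_subgroup P" "P \<subseteq> K" "B \<subseteq> P" "B \<subseteq> D"
    using assms by (auto simp: max_cluster_def cluster_def)
  then have "cluster (D \<inter> P)"
    by (auto simp: cluster_def)
  with assms P have "D \<inter> P = B"
    by (auto simp: max_cluster_def)
  with P that show ?thesis
    by blast
qed

lemma max_cluster_stable:
  assumes "max_cluster B" "s \<in> B"
  shows "conjg s B = B"
proof -
  obtain P where P: "p_subgroup P" "P \<subseteq> K" "B = D \<inter> P"
    using max_cluster_trace[OF assms(1)] .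
  then show ?thesis
    using trace_stable[OF p_subgroup_subgroup[OF P(1)] P(2)] assms(2) by blast
qed

text \<open>Descending induction on the size of the intersection \<open>T\<close>. Growth of
  normalizers gives \<open>d\<close> in \<open>B - C\<close> and \<open>e\<close> in
  \<open>C - B\<close> stabilizing \<open>T\<close>, so \<open>T\<close> with \<open>d\<close> and
  \<open>e\<close> is a cluster. A maximal cluster above it meets both \<open>B\<close> and
  \<open>C\<close> in more than \<open>T\<close>, hence equals both.\<close>

lemma max_clusters_disjoint:
  assumes "max_cluster B" "max_cluster C" "B \<inter> C \<noteq> {}"
  shows "B = C"
  using assms
proof (induction "card D - card (B \<inter> C)" arbitrary: B C rule: less_induct)
  case less
  show ?case
  proof (rule ccontr)
    assume "B \<noteq> C"
    obtain P where P: "p_subgroup P" "P \<subseteq> K" "B = D \<inter> P"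
      using max_cluster_trace[OF less.prems(1)] .
    obtain Q where Q: "p_subgroup Q" "Q \<subseteq> K" "C = D \<inter> Q"
      using max_cluster_trace[OF less.prems(2)] .
    define T where "T = B \<inter> C"
    have T_eq: "T = D \<inter> P \<inter> Q" "T = D \<inter> Q \<inter> P" "T = D \<inter> (P \<inter> Q)"
      using P Q by (auto simp: T_def)
    have cl: "cluster B" "cluster C"
      using less.prems by (auto simp: max_cluster_def)
    have "\<not> B \<subseteq> C" "\<not> C \<subseteq> B"
      using less.prems \<open>B \<noteq> C\<close> by (auto simp: max_cluster_def)
    then have "\<not> D \<inter> P \<subseteq> Q" "\<not> D \<inter> Q \<subseteq> P"
      using P(3) Q(3) by auto
    obtain d where d: "d \<in> D \<inter> P - Q" "conjg d T = T"
      using normalizer_grows_on_trace[OF P(1) Q(1) D_sub(2) _ \<open>\<not> D \<inter> P \<subseteq> Q\<close>] D_conj P(2) T_eq(1) by auto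
    obtain e where e: "e \<in> D \<inter> Q - P" "conjg e T = T"
      using normalizer_grows_on_trace[OF Q(1) P(1) D_sub(2) _ \<open>\<not> D \<inter> Q \<subseteq> P\<close>] D_conj Q(2) T_eq(2) by auto
    have PQ: "subgroup (P \<inter> Q) G"
      using P(1) Q(1) by (simp add: p_subgroup_subgroup subgroups_Inter_pair)
    have "cluster (insert d (insert e T))"
    proof (rule cluster_if_stabilizes[of T])
      show "cluster T"
        using cluster_mono[OF cl(1)] by (simp add: T_def)
      show "T \<noteq> {}"
        using less.prems(3) by (simp add: T_def)
      show "insert d (insert e T) \<subseteq> D"
        using d e T_eq by auto
      show "conjg s T = T" if "s \<in> insert d (insert e T)" for s
        using that d(2) e(2) trace_stable[OF PQ] P(2) T_eq(3) by auto
    qed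
    then obtain E where E: "max_cluster E" "insert d (insert e T) \<subseteq> E"
      using max_cluster_ext by blast
    have larger: "E = F" if F: "max_cluster F" "T \<subseteq> F" and u: "u \<in> E \<inter> F" "u \<notin> T" for F u
    proof (rule less.hyps[OF _ E(1) F(1)])
      have "cluster F"
        using F(1) by (simp add: max_cluster_def)
      then have "finite F" "F \<subseteq> D"
        using finite_cluster cluster_D by auto
      have "T \<subset> E \<inter> F"
        using E(2) F(2) u by auto
      then have "card T < card (E \<inter> F)"
        using \<open>finite F\<close> by (simp add: psubset_card_mono)
      moreover have "card (E \<inter> F) \<le> card D"
        using \<open>F \<subseteq> D\<close> by (intro card_mono finite_D) auto
      ultimately show "card D - card (E \<inter> F) < card D - card (B \<inter> C)"
        by (simp add: T_def)
      show "E \<inter> F \<noteq> {}"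
        using u by auto
    qed
    have "E = B"
      using larger[OF less.prems(1), of d] d(1) E(2) P(3) T_eq(1) by (auto simp: T_def)
    moreover have "E = C"
      using larger[OF less.prems(2), of e] e(1) E(2) Q(3) T_eq(1) by (auto simp: T_def)
    ultimately show False
      using \<open>B \<noteq> C\<close> by simp
  qed
qed

text \<open>A largest cluster \<open>B\<close> and the conjugates under the powers of an element of \<open>B\<close> of some
  \<open>K\<close>-conjugate of \<open>B\<close> are \<open>p + 1\<close> pairwise disjoint subsets of \<open>D\<close>.\<close>

lemma card_cluster_bound:
  assumes "cluster C"
  shows "(p + 1) * card C \<le> card D"
proof -
  define M where "M = Max (card ` {C. cluster C})"
  have fin: "finite (card ` {C. cluster C})" and ne: "card ` {C. cluster C} \<noteq> {}"
    using finite_clusters assms by blast+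
  obtain B where B: "cluster B" and card_B: "card B = M"
    using Max_in[OF fin ne] unfolding M_def by (metis imageE mem_Collect_eq)
  have largest: "card C \<le> card B" if "cluster C" for C
    unfolding card_B M_def by (rule Max_ge[OF fin]) (use that in simp)
  have largest_max: "max_cluster A" if A: "cluster A" "card A = card B" for A
    unfolding max_cluster_def
  proof (intro conjI allI impI)
    fix E assume E: "cluster E" "A \<subseteq> E"
    have "A = E"
      by (rule card_seteq[OF finite_cluster[OF E(1)] E(2)]) (use largest[OF E(1)] A(2) in simp)
    then show "E = A" ..
  qed fact
  have Bmax: "max_cluster B"
    using largest_max B by blast
  obtain d0 where "d0 \<in> D"
    using D_nonempty by blast
  \<comment> \<open>Singletons of \<open>D\<close> are clusters, so a largest cluster is
    nonempty.\<close>
  then have "card B \<noteq> 0"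
    using largest[OF cluster_singleton[of d0]] by simp
  then obtain d where d: "d \<in> B"
    by fastforce
  note BG = cluster_carrier[OF B]
  have dp: "d \<in> p_elements G p" and dG: "d \<in> carrier G" and dK: "d \<in> K" and dD: "d \<in> D"
    using d cluster_D[OF B] D_sub by auto
  obtain k where k: "k \<in> K" "conjg k B \<noteq> B"
    using cluster_moved[OF B] d by blast
  define B' where "B' = conjg k B"
  have B': "cluster B'" "card B' = card B" "B' \<noteq> B"
    using cluster_conjg[OF B k(1)] card_conjg[OF KG[OF k(1)] BG] k(2) by (simp_all add: B'_def)
  note B'G = cluster_carrier[OF B'(1)]
  have B'max: "max_cluster B'"
    using largest_max B' by blast
  have "B \<inter> B' = {}"
    using max_clusters_disjoint[OF Bmax B'max] B'(3) by blast
  have "B' \<noteq> {}"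
    using B'(2) \<open>card B \<noteq> 0\<close> by auto
  define H where "H = {g \<in> carrier G. conjg g B' = B'}"
  have H: "subgroup H G"
    unfolding H_def by (rule stabilizer_conjg_subgroup[OF B'G])
  \<comment> \<open>If \<open>d\<close> stabilized \<open>B'\<close>, then
    \<open>insert d B'\<close> would be a cluster, and maximality would put \<open>d\<close> into
    \<open>B \<inter> B'\<close>.\<close>
  have "d \<notin> H"
  proof
    assume "d \<in> H"
    then have "cluster (insert d B')"
      using cluster_if_stabilizes[OF B'(1) \<open>B' \<noteq> {}\<close>, of "insert d B'"] max_cluster_stable[OF B'max]
        dD cluster_D[OF B'(1)] by (auto simp: H_def)
    then have "d \<in> B'"
      using B'max by (auto simp: max_cluster_def)
    with d \<open>B \<inter> B' = {}\<close> show False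
      by blast
  qed
  define F where "F i = conjg (d [^] i) B'" for i :: nat
  have dpow: "d [^] i \<in> K" for i :: nat
    using subgroup_int_pow_closed[OF K dK, of "int i"] by (simp add: int_pow_int)
  have F: "cluster (F i)" "card (F i) = card B" for i
    using cluster_conjg[OF B'(1) dpow] card_conjg[OF KG[OF dpow] B'G] B'(2) by (simp_all add: F_def)
  have Fmax: "max_cluster (F i)" for i
    using largest_max F by blast
  \<comment> \<open>Powers of \<open>d\<close> stabilize \<open>B\<close>, so they cannot move
    \<open>B'\<close> onto \<open>B\<close>.\<close>
  have F_ne_B: "F i \<noteq> B" for i
  proof
    assume "F i = B"
    have "d [^] i \<in> {g \<in> carrier G. conjg g B = B}"
      using subgroup_int_pow_closed[OF stabilizer_conjg_subgroup[OF BG], of d "int i"]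
        max_cluster_stable[OF Bmax d] dG by (simp add: int_pow_int)
    then have "F i = conjg (d [^] i) B"
      using \<open>F i = B\<close> by simp
    then show False
      using conjg_inv_cancel(1)[OF KG[OF dpow] B'G, of i] conjg_inv_cancel(1)[OF KG[OF dpow] BG, of i] B'(3)
      by (simp add: F_def)
  qed
  \<comment> \<open>Equal conjugates would put \<open>d [^] (j - i)\<close>, with exponent strictly
    between 0 and \<open>p\<close>, into \<open>H\<close>, and with it the \<open>p\<close>-element
    \<open>d\<close>.\<close>
  have F_ne: "F i \<noteq> F j" if "i < j" "j < p" for i j
  proof
    assume "F i = F j"
    have "d [^] j = d [^] i \<otimes> d [^] (j - i)"
      using that dG by (simp add: nat_pow_mult)
    then have "F j = conjg (d [^] i) (conjg (d [^] (j - i)) B')"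
      using dG B'G by (simp add: F_def conjg_mult)
    then have "conjg (d [^] (j - i)) B' = B'"
      using \<open>F i = F j\<close> conjg_inv_cancel(1)[of "d [^] i"] B'G dG conjg_closed[OF _ B'G, of "d [^] (j - i)"]
      by (metis F_def nat_pow_closed)
    then have "d [^] (j - i) \<in> H"
      using dG by (simp add: H_def)
    then show False
      using p_element_mem_subgroup_if_pow_mem[OF dp H, of "j - i"] that \<open>d \<notin> H\<close> by linarith
  qed
  have disj: "F i \<inter> F j = {}" if "i < p" "j < p" "i \<noteq> j" for i j
    using max_clusters_disjoint[OF Fmax[of i] Fmax[of j]] F_ne[of i j] F_ne[of j i] that by (metis nat_neq_iff)
  have B_disj: "B \<inter> (\<Union>i<p. F i) = {}"
    using max_clusters_disjoint[OF Bmax Fmax] F_ne_B by blast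
  have "card (\<Union>i<p. F i) = (\<Sum>i<p. card (F i))"
    using F(1) finite_cluster disj by (intro card_UN_disjoint) auto
  then have "card (B \<union> (\<Union>i<p. F i)) = (p + 1) * card B"
    using card_Un_disjoint[OF finite_cluster[OF B] _ B_disj] F finite_cluster by simp
  moreover have "B \<union> (\<Union>i<p. F i) \<subseteq> D"
    using cluster_D B F(1) by blast
  ultimately have "(p + 1) * card B \<le> card D"
    using card_mono[OF finite_D] by metis
  moreover have "(p + 1) * card C \<le> (p + 1) * card B"
    using largest[OF assms] mult_le_mono2 by blast
  ultimately show ?thesis
    by simp
qed

text \<open>Two elements of \<open>D\<close> commuting with \<open>y\<close> generate a subgroup of
  its centralizer, which does not contain \<open>K\<close>, so they form a cluster. Disjointness
  then places all such elements in a single maximal cluster.\<close>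

lemma card_centralizer_D_bound:
  assumes y: "y \<in> carrier G" and k: "k \<in> K" "y \<otimes> k \<noteq> k \<otimes> y"
  shows "(p + 1) * card {d \<in> D. y \<otimes> d = d \<otimes> y} \<le> card D"
proof (cases "{d \<in> D. y \<otimes> d = d \<otimes> y} = {}")
  case False
  then obtain d where d: "d \<in> D" "y \<otimes> d = d \<otimes> y"
    by blast
  obtain B where B: "max_cluster B" "{d} \<subseteq> B"
    using max_cluster_ext[OF cluster_singleton[OF d(1)]] .
  have "e \<in> B" if e: "e \<in> D" "y \<otimes> e = e \<otimes> y" for e
  proof -
    have "{d, e} \<subseteq> centralizer G y"
      using d e D_sub by (auto simp: centralizer_def)
    then have "generate G {d, e} \<subseteq> centralizer G y"
      by (rule generate_subgroup_incl[OF _ centralizer_subgroup[OF is_group y]])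
    then have "generate G {d, e} \<noteq> K"
      using k by (auto simp: centralizer_def)
    then have "cluster {d, e}"
      using cluster_if_generate_ne d(1) e(1) by simp
    then obtain E where "max_cluster E" "{d, e} \<subseteq> E"
      using max_cluster_ext by blast
    then show ?thesis
      using max_clusters_disjoint[OF B(1), of E] B(2) by blast
  qed
  then have "{d \<in> D. y \<otimes> d = d \<otimes> y} \<subseteq> B"
    by blast
  moreover have "cluster B"
    using B(1) by (simp add: max_cluster_def)
  ultimately show ?thesis
    using card_cluster_bound cluster_mono by blast
next
  case True
  then show ?thesis
    by (simp only: card.empty)
qed

text \<open>Let \<open>N\<close> be the set of \<open>p\<close>-elements centralizing
  \<open>K\<close>. Double counting gives
  \<open>(p + 1) * a \<le> card (p_elements G p) + p * card N\<close>, and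
  \<open>p * card N \<le> a\<close> absorbs the last term.\<close>

lemma card_p_elements_ge:
  assumes a: "\<And>d. d \<in> X \<Longrightarrow> card {y \<in> p_elements G p. y \<otimes> d = d \<otimes> y} = a"
  shows "p * a \<le> card (p_elements G p)"
proof -
  define Z where "Z = {y \<in> carrier G. \<forall>k\<in>K. y \<otimes> k = k \<otimes> y}"
  define N where "N = p_elements G p \<inter> Z"
  have Z: "subgroup Z G"
  proof -
    have "Z = (\<Inter>k\<in>K. centralizer G k)"
      using subgroup.one_closed[OF K] by (auto simp: Z_def centralizer_def)
    then show ?thesis
      using subgroups_Inter[of "centralizer G ` K"] centralizer_subgroup[OF is_group KG] subgroup.one_closed[OF K]
      by auto
  qed
  have DX: "d \<in> X" if "d \<in> D" for d
    using that by (simp add: D_def)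
  obtain d where d: "d \<in> D"
    using D_nonempty by blast
  have dG: "d \<in> carrier G" and dp: "d \<in> p_elements G p" and dK: "d \<in> K"
    using d D_sub by auto
  \<comment> \<open>Otherwise \<open>K\<close> would fix the cluster \<open>{d}\<close>, against
    \<open>cluster_moved\<close>.\<close>
  have "d \<notin> Z"
  proof
    assume "d \<in> Z"
    then have "conjg k {d} = {d}" if "k \<in> K" for k
      using that KG[OF that] dG by (simp add: conjg_def Z_def inv_solve_right')
    then show False
      using cluster_moved[OF cluster_singleton[OF d]] by blast
  qed
  \<comment> \<open>Elements of \<open>N\<close> times powers of \<open>d\<close> are
    \<open>p\<close>-elements commuting with \<open>d\<close>, and powers with exponent below
    \<open>p\<close> separate cosets of \<open>Z\<close>.\<close>
  have "card (N \<times> {..<p}) \<le> card {y \<in> p_elements G p. y \<otimes> d = d \<otimes> y}"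
  proof (rule card_inj_on_le)
    show "inj_on (\<lambda>(s, i). s \<otimes> d [^] (i::nat)) (N \<times> {..<p})"
      by (rule inj_on_mult_p_element_powers[OF dp Z \<open>d \<notin> Z\<close>]) (simp add: N_def)
    show "finite {y \<in> p_elements G p. y \<otimes> d = d \<otimes> y}"
      using finite_p_elements by simp
    have "s \<otimes> d [^] i \<in> {y \<in> p_elements G p. y \<otimes> d = d \<otimes> y}" if s: "s \<in> N" for s and i :: nat
    proof -
      have sG: "s \<in> carrier G" and sp: "s \<in> p_elements G p" and sd: "s \<otimes> d = d \<otimes> s"
        using s dK by (auto simp: N_def Z_def)
      have c: "s \<otimes> d [^] i = d [^] i \<otimes> s"
        using group_commutes_pow[OF sd[symmetric] dG sG] by simp
      have "s \<otimes> d [^] i \<otimes> d = d \<otimes> (s \<otimes> d [^] i)"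
        using group_commutes_pow[of d d i] sG dG sd by (metis m_assoc nat_pow_closed)
      then show ?thesis
        using p_elements_commuting_mult[OF sp p_elements_pow[OF dp] c] by simp
    qed
    then show "(\<lambda>(s, i). s \<otimes> d [^] i) ` (N \<times> {..<p}) \<subseteq> {y \<in> p_elements G p. y \<otimes> d = d \<otimes> y}"
      by auto
  qed
  then have N_le: "p * card N \<le> a"
    using a[OF DX[OF d]] by (simp add: card_cartesian_product mult.commute)
  let ?c = "\<lambda>y. card {d \<in> D. y \<otimes> d = d \<otimes> y}"
  have N_sub: "N \<subseteq> p_elements G p"
    by (simp add: N_def)
  have "card D * a = (\<Sum>d\<in>D. card {y \<in> p_elements G p. y \<otimes> d = d \<otimes> y})"
    using a DX by simp
  also have "\<dots> = (\<Sum>y\<in>p_elements G p. ?c y)"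
    using sum.swap_restrict[OF finite_D finite_p_elements, of "\<lambda>_ _. 1::nat" "\<lambda>d y. y \<otimes> d = d \<otimes> y"]
    by simp
  \<comment> \<open>Weighting by \<open>p + 1\<close> lets the bound on \<open>?c y\<close> enter
    without division.\<close>
  finally have "(p + 1) * (card D * a) = (\<Sum>y\<in>p_elements G p. (p + 1) * ?c y)"
    by (simp add: sum_distrib_left)
  also have "\<dots> = (\<Sum>y\<in>p_elements G p - N. (p + 1) * ?c y) + (\<Sum>y\<in>N. (p + 1) * ?c y)"
    by (rule sum.subset_diff[OF N_sub finite_p_elements])
  also have "\<dots> \<le> (\<Sum>y\<in>p_elements G p - N. card D) + (\<Sum>y\<in>N. (p + 1) * card D)"
  proof (intro add_mono sum_mono mult_le_mono2)
    fix y assume "y \<in> p_elements G p - N"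
    then obtain k where "y \<in> carrier G" "k \<in> K" "y \<otimes> k \<noteq> k \<otimes> y"
      using p_elements_subset by (auto simp: N_def Z_def)
    then show "(p + 1) * ?c y \<le> card D"
      by (rule card_centralizer_D_bound)
  qed (auto intro: card_mono finite_D)
  also have "\<dots> = card D * ((card (p_elements G p) - card N) + (p + 1) * card N)"
    using card_Diff_subset[OF finite_subset[OF N_sub finite_p_elements] N_sub]
    by (simp add: algebra_simps)
  \<comment> \<open>The truncated subtraction is exact because \<open>N\<close> consists of
    \<open>p\<close>-elements.\<close>
  also have "(card (p_elements G p) - card N) + (p + 1) * card N = card (p_elements G p) + p * card N"
    using card_mono[OF finite_p_elements N_sub] by simp
  also have "card D * \<dots> \<le> card D * (card (p_elements G p) + a)"
    using N_le by simp
  finally have "card D * ((p + 1) * a) \<le> card D * (card (p_elements G p) + a)"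
    by (simp only: ac_simps)
  moreover have "card D \<noteq> 0"
    using D_nonempty finite_D by simp
  ultimately have "(p + 1) * a \<le> card (p_elements G p) + a"
    by (simp only: nat_mult_le_cancel1)
  then show ?thesis
    by simp
qed

end

section \<open>Elements commuting with many \<open>p\<close>-elements\<close>

context finite_group_prime
begin

definition cent_p :: "'a \<Rightarrow> 'a set" where
  "cent_p x = {y \<in> p_elements G p. y \<otimes> x = x \<otimes> y}"

lemma finite_cent_p: "finite (cent_p x)"
  using finite_p_elements by (simp add: cent_p_def)

lemma card_cent_p_conj_le:
  assumes g: "g \<in> carrier G" and x: "x \<in> carrier G"
  shows "card (cent_p x) \<le> card (cent_p (g \<otimes> x \<otimes> inv g))"
proof -
  have "g \<otimes> y \<otimes> inv g \<in> cent_p (g \<otimes> x \<otimes> inv g)" if y: "y \<in> cent_p x" for y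
  proof -
    have yG: "y \<in> carrier G" and yp: "y \<in> p_elements G p" and c: "y \<otimes> x = x \<otimes> y"
      using y p_elements_subset by (auto simp: cent_p_def)
    have mult: "(g \<otimes> a \<otimes> inv g) \<otimes> (g \<otimes> b \<otimes> inv g) = g \<otimes> (a \<otimes> b) \<otimes> inv g"
      if "a \<in> carrier G" "b \<in> carrier G" for a b
      using that g by (simp add: m_assoc inv_solve_left')
    show ?thesis
      using p_elements_conj[OF g yp] mult yG x c by (simp add: cent_p_def)
  qed
  then have "conjg g (cent_p x) \<subseteq> cent_p (g \<otimes> x \<otimes> inv g)"
    by (auto simp: conjg_def)
  then show ?thesis
    using card_mono[OF finite_cent_p] card_conjg[OF g, of "cent_p x"] p_elements_subset
    by (metis (no_types, lifting) cent_p_def mem_Collect_eq subset_iff)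
qed

text \<open>Conjugating back by \<open>inv g\<close> gives the reverse inequality.\<close>

lemma card_cent_p_conj:
  assumes g: "g \<in> carrier G" and x: "x \<in> carrier G"
  shows "card (cent_p (g \<otimes> x \<otimes> inv g)) = card (cent_p x)"
  using card_cent_p_conj_le[OF g x] card_cent_p_conj_le[of "inv g" "g \<otimes> x \<otimes> inv g"]
    conj_mult[of "inv g" g x] g x by simp

lemma mem_core_if_many_commuting:
  assumes x: "x \<in> p_elements G p" and many: "card (p_elements G p) < p * card (cent_p x)"
  shows "x \<in> core_of (carrier G)"
proof (rule ccontr)
  assume "x \<notin> core_of (carrier G)"
  define X where "X = {g \<otimes> x \<otimes> inv g | g. g \<in> carrier G}"
  have xG: "x \<in> carrier G"
    using x p_elements_subset by auto
  have "x \<in> X"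
    using xG by (auto simp: X_def intro!: exI[of _ \<one>])
  \<comment> \<open>\<open>G\<close> itself has this property because \<open>x\<close> lies in
    \<open>X\<close>. A subgroup of least order with it serves as \<open>K\<close>, since proper
    subgroups have smaller order.\<close>
  define esc where "esc K \<longleftrightarrow> subgroup K G \<and> \<not> X \<inter> K \<subseteq> core_of K" for K
  have "esc (carrier G)"
    using \<open>x \<in> X\<close> xG \<open>x \<notin> core_of (carrier G)\<close> subgroup_self by (auto simp: esc_def)
  then obtain K where K: "esc K" and least: "\<And>L. esc L \<Longrightarrow> card K \<le> card L"
    using ex_has_least_nat[of esc "carrier G" card] by blast
  interpret minimal_escape G p X K
  proof (rule minimal_escape.intro[OF finite_group_prime_axioms minimal_escape_axioms.intro])
    show "X \<subseteq> p_elements G p"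
      using p_elements_conj x by (auto simp: X_def)
    show "subgroup K G" "\<not> X \<inter> K \<subseteq> core_of K"
      using K by (auto simp: esc_def)
    show "g \<otimes> z \<otimes> inv g \<in> X" if gz: "g \<in> carrier G" "z \<in> X" for g z
    proof -
      obtain h where "h \<in> carrier G" "z = h \<otimes> x \<otimes> inv h"
        using gz(2) by (auto simp: X_def)
      then show ?thesis
        using conj_mult[of g h x] gz(1) xG by (auto simp: X_def intro!: exI[of _ "g \<otimes> h"])
    qed
    show "X \<inter> L \<subseteq> core_of L" if "subgroup L G" "L \<subset> K" for L
    proof -
      have "finite K"
        using K finite_subset[OF subgroup.subset finite_carrier] by (simp add: esc_def)
      then have "card L < card K"
        using that(2) by (rule psubset_card_mono)
      then show ?thesis
        using least[of L] that(1) by (auto simp: esc_def)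
    qed
  qed
  have "p * card (cent_p x) \<le> card (p_elements G p)"
  proof (rule card_p_elements_ge)
    show "card {y \<in> p_elements G p. y \<otimes> d = d \<otimes> y} = card (cent_p x)" if "d \<in> X" for d
      using that card_cent_p_conj[OF _ xG] by (auto simp: X_def cent_p_def)
  qed
  with many show False
    by simp
qed

text \<open>\<open>(c n)\<^sup>k \<in> c\<^sup>k N\<close>, so \<open>p\<close>-elements form a union of cosets of a normal \<open>p\<close>-subgroup.\<close>

lemma p_elements_mult_normal:
  assumes N: "p_subgroup N" and inv: "\<And>g n. g \<in> carrier G \<Longrightarrow> n \<in> N \<Longrightarrow> g \<otimes> n \<otimes> inv g \<in> N"
    and c: "c \<in> p_elements G p" and n: "n \<in> N"
  shows "c \<otimes> n \<in> p_elements G p"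
proof -
  note sN = p_subgroup_subgroup[OF N]
  have cG: "c \<in> carrier G" and nG: "n \<in> carrier G"
    using c p_elements_subset n subgroup.mem_carrier[OF sN] by auto
  have pow: "\<exists>u\<in>N. (c \<otimes> n) [^] k = c [^] k \<otimes> u" for k :: nat
  proof (induction k)
    case 0
    then show ?case
      using subgroup.one_closed[OF sN] by (auto intro!: bexI[of _ \<one>])
  next
    case (Suc k)
    then obtain u where u: "u \<in> N" "(c \<otimes> n) [^] k = c [^] k \<otimes> u"
      by blast
    have uG: "u \<in> carrier G"
      using u(1) subgroup.mem_carrier[OF sN] by blast
    \<comment> \<open>Moving \<open>u\<close> to the right past the next factor \<open>c\<close>
      turns it into this conjugate.\<close>
    have "inv c \<otimes> u \<otimes> c \<in> N"
      using inv[of "inv c" u] u(1) cG by simp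
    then have "inv c \<otimes> u \<otimes> c \<otimes> n \<in> N"
      using n subgroup.m_closed[OF sN] by blast
    moreover have "(c \<otimes> n) [^] Suc k = c [^] Suc k \<otimes> (inv c \<otimes> u \<otimes> c \<otimes> n)"
    proof -
      have "c [^] Suc k \<otimes> (inv c \<otimes> u \<otimes> c \<otimes> n) = c [^] k \<otimes> (c \<otimes> inv c) \<otimes> u \<otimes> c \<otimes> n"
        using cG nG uG by (simp only: nat_pow_Suc m_assoc m_closed inv_closed nat_pow_closed)
      then show ?thesis
        using u(2) cG nG uG by (simp add: m_assoc)
    qed
    ultimately show ?case
      by blast
  qed
  \<comment> \<open>The exponent \<open>p ^ m\<close> kills \<open>c\<close> and leaves an element
    of \<open>N\<close>, which a further power of \<open>p\<close> kills.\<close>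
  obtain m where "c [^] (p ^ m) = \<one>"
    using c by (auto simp: p_elements_iff)
  moreover obtain u where u: "u \<in> N" "(c \<otimes> n) [^] (p ^ m) = c [^] (p ^ m) \<otimes> u"
    using pow by blast
  ultimately have "(c \<otimes> n) [^] (p ^ m) = u"
    using subgroup.mem_carrier[OF sN] by simp
  moreover have "u \<in> p_elements G p"
    using u(1) p_subgroup_p_elements[OF N] by blast
  then obtain l where "u [^] (p ^ l) = \<one>"
    by (auto simp: p_elements_iff)
  ultimately have "(c \<otimes> n) [^] (p ^ (m + l)) = \<one>"
    using cG nG by (metis m_closed nat_pow_pow power_add)
  then show ?thesis
    using cG nG by (auto simp: p_elements_iff)
qed

text \<open>A core element \<open>n\<close> outside the centralizer of \<open>x\<close> has its
  powers below \<open>p\<close> in distinct cosets of that centralizer. Multiplying by them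
  preserves \<open>p\<close>-elements because the core is normal, so there would be too many
  \<open>p\<close>-elements.\<close>

lemma commutes_with_core_if_many_commuting:
  assumes x: "x \<in> carrier G" and many: "card (p_elements G p) < p * card (cent_p x)"
    and n: "n \<in> core_of (carrier G)"
  shows "x \<otimes> n = n \<otimes> x"
proof (rule ccontr)
  assume ne: "x \<otimes> n \<noteq> n \<otimes> x"
  note core = core_of_p_subgroup[OF subgroup_self]
  note C = centralizer_subgroup[OF is_group x]
  have np: "n \<in> p_elements G p"
    using n p_subgroup_p_elements[OF core(1)] by blast
  have "n \<notin> centralizer G x"
    using ne by (auto simp: centralizer_def)
  have "card (cent_p x \<times> {..<p}) \<le> card (p_elements G p)"
  proof (rule card_inj_on_le)
    show "inj_on (\<lambda>(s, i). s \<otimes> n [^] (i::nat)) (cent_p x \<times> {..<p})"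
      by (rule inj_on_mult_p_element_powers[OF np C \<open>n \<notin> _\<close>])
        (use p_elements_subset in \<open>auto simp: cent_p_def centralizer_def\<close>)
    have "n [^] i \<in> core_of (carrier G)" for i :: nat
      using subgroup_int_pow_closed[OF p_subgroup_subgroup[OF core(1)] n, of "int i"] by (simp add: int_pow_int)
    then show "(\<lambda>(s, i). s \<otimes> n [^] i) ` (cent_p x \<times> {..<p}) \<subseteq> p_elements G p"
      using p_elements_mult_normal[OF core(1) core(3)] by (auto simp: cent_p_def)
  qed (rule finite_p_elements)
  with many show False
    by (simp add: card_cartesian_product mult.commute)
qed

end

theorem theoremD:
  fixes G :: "('a, 'b) monoid_scheme" and p :: nat and x :: 'a
  assumes "group G" and "finite (carrier G)" and "Factorial_Ring.prime p"
    and "x \<in> p_elements G p"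
    and "real (card (p_elements (G\<lparr>carrier := centralizer G x\<rparr>) p)) / real (card (p_elements G p))
          > 1 / real p"
  shows "x \<in> center (G\<lparr>carrier := p_core G p\<rparr>)"
proof -
  interpret group G by fact
  interpret finite_group_prime G p
    by unfold_locales fact+
  have xG: "x \<in> carrier G"
    using assms(4) p_elements_subset by blast
  have "p_elements (G\<lparr>carrier := centralizer G x\<rparr>) p = cent_p x"
    using p_elements_subgroup[OF assms(1) centralizer_subgroup[OF assms(1) xG], of p] p_elements_subset
    by (auto simp: cent_p_def centralizer_def)
  \<comment> \<open>The denominators may be cleared: \<open>x\<close> itself shows that the set of
    \<open>p\<close>-elements is nonempty.\<close>
  moreover have "0 < card (p_elements G p)" "0 < p"
    using assms(4) finite_p_elements prime_gt_0_nat[OF prime_p] by (auto simp: card_gt_0_iff)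
  ultimately have "real (card (p_elements G p)) < real p * real (card (cent_p x))"
    using assms(5) by (simp add: field_simps)
  then have many: "card (p_elements G p) < p * card (cent_p x)"
    by (simp flip: of_nat_mult)
  \<comment> \<open>Updating \<open>G\<close> with its own carrier leaves the record
    unchanged.\<close>
  have "core_of (carrier G) = p_core G p"
    by (simp add: core_of_def)
  then show ?thesis
    using mem_core_if_many_commuting[OF assms(4) many] commutes_with_core_if_many_commuting[OF xG many]
    by (simp add: center_def)
qed

end
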